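(* Let $\Phi$ be the root system of type $G_2$ with simple roots $a$ (short) and $b$ (long), and let $N_{r,s}$ ($r,s\in\Phi$, $r+s\neq 0$) be the structure constants of the complex simple Lie algebra of type $G_2$ with respect to a Chevalley basis. Write $$N_{a,b}=\epsilon_1,\quad N_{a,a+b}=2\epsilon_2,\quad N_{a,2a+b}=3\epsilon_3,\quad N_{b,3a+b}=\epsilon_4,\qquad \epsilon_5=\frac{\epsilon_1\epsilon_3}{\epsilon_4}.$$ Then the nonzero structure constants $N_{r,s}$ are exactly the following (all $N_{r,s}$ with $r+s\ne 0$ not listed are zero): Row $r=-3a-2b$: $N_{r,b}=\epsilon_4,\ N_{r,a+b}=-\epsilon_5,\ N_{r,2a+b}=\epsilon_5,\ N_{r,3a+b}=-\epsilon_4$. Row $r=-3a-b$: $N_{r,-b}=\epsilon_4,\ N_{r,a}=\epsilon_3,\ N_{r,2a+b}=-\epsilon_3,\ N_{r,3a+2b}=-\epsilon_4$. Row $r=-2a-b$: $N_{r,-a-b}=-3\epsilon_5,\ N_{r,-a}=3\epsilon_3,\ N_{r,a}=2\epsilon_2,\ N_{r,a+b}=-2\epsilon_2,\ N_{r,3a+b}=-\epsilon_3,\ N_{r,3a+2b}=\epsilon_5$. Row $r=-a-b$: $N_{r,-2a-b}=3\epsilon_5,\ N_{r,-a}=2\epsilon_2,\ N_{r,a}=3\epsilon_1,\ N_{r,b}=-\epsilon_1,\ N_{r,2a+b}=-2\epsilon_2,\ N_{r,3a+2b}=-\epsilon_5$. Row $r=-b$: $N_{r,-3a-b}=-\epsilon_4,\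 N_{r,-a}=\epsilon_1,\ N_{r,a+b}=-\epsilon_1,\ N_{r,3a+2b}=\epsilon_4$. Row $r=-a$: $N_{r,-2a-b}=-3\epsilon_3,\ N_{r,-a-b}=-2\epsilon_2,\ N_{r,-b}=-\epsilon_1,\ N_{r,a+b}=3\epsilon_1,\ N_{r,2a+b}=2\epsilon_2,\ N_{r,3a+b}=\epsilon_3$. Row $r=a$: $N_{r,-3a-b}=-\epsilon_3,\ N_{r,-2a-b}=-2\epsilon_2,\ N_{r,-a-b}=-3\epsilon_1,\ N_{r,b}=\epsilon_1,\ N_{r,a+b}=2\epsilon_2,\ N_{r,2a+b}=3\epsilon_3$. Row $r=b$: $N_{r,-3a-2b}=-\epsilon_4,\ N_{r,-a-b}=\epsilon_1,\ N_{r,a}=-\epsilon_1,\ N_{r,3a+b}=\epsilon_4$. Row $r=a+b$: $N_{r,-3a-2b}=\epsilon_5,\ N_{r,-2a-b}=2\epsilon_2,\ N_{r,-a}=-3\epsilon_1,\ N_{r,-b}=\epsilon_1,\ N_{r,a}=-2\epsilon_2,\ N_{r,2a+b}=-3\epsilon_5$. Row $r=2a+b$: $N_{r,-3a-2b}=-\epsilon_5,\ N_{r,-3a-b}=\epsilon_3,\ N_{r,-a-b}=2\epsilon_2,\ N_{r,-a}=-2\epsilon_2,\ N_{r,a}=-3\epsilon_3,\ N_{r,a+b}=3\epsilon_5$. Row $r=3a+b$: $N_{r,-3a-2b}=\epsilon_4,\ N_{r,-2a-b}=\epsilon_3,\ N_{r,-a}=-\epsilon_3,\ N_{r,b}=-\epsilon_4$.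 Row $r=3a+2b$: $N_{r,-3a-b}=\epsilon_4,\ N_{r,-2a-b}=-\epsilon_5,\ N_{r,-a-b}=\epsilon_5,\ N_{r,-b}=-\epsilon_4$.
   Context: Root system: in Euclidean $\mathbb{R}^3$ with orthonormal basis $\varepsilon_1,\varepsilon_2,\varepsilon_3$ put $a=\varepsilon_1-\varepsilon_2$, $b=-2\varepsilon_1+\varepsilon_2+\varepsilon_3$, so $(a,a)=2$, $(b,b)=6$, $(a,b)=-3$. The root system $\Phi$ of type $G_2$ is $\{\pm a,\pm b,\pm(a+b),\pm(2a+b),\pm(3a+b),\pm(3a+2b)\}$, with fundamental roots $a,b$. Structure constants: the complex simple Lie algebra of type $G_2$ has a Chevalley basis $\{h_a,h_b\}\cup\{e_r: r\in\Phi\}$, where $[h_r,h_s]=0$, $[h_r,e_s]=\frac{2(r,s)}{(r,r)}e_s$, $[e_r,e_{-r}]=h_r$ (with $h_r$ the coroot element of $r$, an integer combination of $h_a,h_b$), $[e_r,e_s]=N_{r,s}e_{r+s}$ if $r,s,r+s\in\Phi$, and $[e_r,e_s]=0$ if $r+s\notin\Phi\cup\{0\}$, in which case $N_{r,s}:=0$. For a Chevalley basis $N_{-r,-s}=-N_{r,s}$ and $N_{r,s}=\pm(p+1)$ when $r,s,r+s\in\Phi$, where $p$ is the largest integer with $s-pr\in\Phi$. In particular each $\epsilon_i\in\{1,-1\}$. The pairs $(a,b),(a,a+b),(a,2a+b),(b,3a+b)$ are the extraspecial pairs of roots for the ordering $a\prec b\prec a+b\prec 2a+b\prec 3a+b\prec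 3a+2b$. *)

theory Defs
  imports "HOL-Analysis.Analysis"
begin

section \<open>Complex Lie algebras\<close>

locale complex_lie_algebra = vector_space scale
  for scale :: "complex \<Rightarrow> 'g::ab_group_add \<Rightarrow> 'g" +
  fixes bracket :: "'g \<Rightarrow> 'g \<Rightarrow> 'g"
  assumes bracket_add_left: "bracket (x + y) z = bracket x z + bracket y z"
    and bracket_add_right: "bracket x (y + z) = bracket x y + bracket x z"
    and bracket_scale_left: "bracket (scale c x) y = scale c (bracket x y)"
    and bracket_scale_right: "bracket x (scale c y) = scale c (bracket x y)"
    and bracket_self: "bracket x x = 0"
    and jacobi: "bracket x (bracket y z) + bracket y (bracket z x) + bracket z (bracket x y) = 0"
begin

definition lie_ideal :: "'g set \<Rightarrow> bool" where
  "lie_ideal I \<longleftrightarrow> subspace I \<and> (\<forall>x. \<forall>y\<in>I. bracket x y \<in> I)"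

end

locale simple_complex_lie_algebra = complex_lie_algebra scale bracket
  for scale :: "complex \<Rightarrow> 'g::ab_group_add \<Rightarrow> 'g" and bracket +
  assumes nonabelian: "\<exists>x y. bracket x y \<noteq> 0"
    and simple: "lie_ideal I \<Longrightarrow> I = {0} \<or> I = UNIV"

section \<open>Chevalley bases\<close>

definition coroot :: "'v::real_inner \<Rightarrow> 'v" where
  "coroot r = (2 / (r \<bullet> r)) *\<^sub>R r"

text \<open>
  \<open>\<Phi>\<close> is meant to be a reduced root system with base \<open>\<Delta>\<close>. The functions \<open>h\<close> and \<open>e\<close> matter only
  on \<open>\<Phi>\<close>, and \<open>N r s\<close> only for \<open>r, s \<in> \<Phi>\<close> with \<open>r + s \<noteq> 0\<close>. By \<open>coroot_element\<close>, \<open>h r\<close>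
  is the element of the integer span of \<open>h ` \<Delta>\<close> that corresponds to the coroot \<open>2r / (r,r)\<close>.
  The absolute values \<open>\<bar>N r s\<bar> = p + 1\<close> (\<open>p\<close> the largest integer with \<open>s - p r \<in> \<Phi>\<close>) are not
  assumed: given the other conditions, they follow from \<open>N_uminus\<close>.
\<close>

locale chevalley_basis = complex_lie_algebra scale bracket
  for scale :: "complex \<Rightarrow> 'g::ab_group_add \<Rightarrow> 'g" and bracket +
  fixes \<Phi> \<Delta> :: "'v::real_inner set"
    and h e :: "'v \<Rightarrow> 'g"
    and N :: "'v \<Rightarrow> 'v \<Rightarrow> complex"
  assumes inj_h: "inj_on h \<Delta>"
    and inj_e: "inj_on e \<Phi>"
    and disjoint_h_e: "h ` \<Delta> \<inter> e ` \<Phi> = {}"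
    and independent_basis: "independent (h ` \<Delta> \<union> e ` \<Phi>)"
    and span_basis: "span (h ` \<Delta> \<union> e ` \<Phi>) = UNIV"
    and coroot_element: "r \<in> \<Phi> \<Longrightarrow> \<exists>c :: 'v \<Rightarrow> int.
          coroot r = (\<Sum>s\<in>\<Delta>. of_int (c s) *\<^sub>R coroot s) \<and>
          h r = (\<Sum>s\<in>\<Delta>. scale (of_int (c s)) (h s))"
    and bracket_h_h: "\<lbrakk>r \<in> \<Phi>; s \<in> \<Phi>\<rbrakk> \<Longrightarrow> bracket (h r) (h s) = 0"
    and bracket_h_e: "\<lbrakk>r \<in> \<Phi>; s \<in> \<Phi>\<rbrakk> \<Longrightarrow>
          bracket (h r) (e s) = scale (of_real (2 * (r \<bullet> s) / (r \<bullet> r))) (e s)"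
    and bracket_e_uminus: "r \<in> \<Phi> \<Longrightarrow> bracket (e r) (e (- r)) = h r"
    and bracket_e_e: "\<lbrakk>r \<in> \<Phi>; s \<in> \<Phi>; r + s \<in> \<Phi>\<rbrakk> \<Longrightarrow>
          bracket (e r) (e s) = scale (N r s) (e (r + s))"
    and bracket_e_e_zero: "\<lbrakk>r \<in> \<Phi>; s \<in> \<Phi>; r + s \<notin> \<Phi> \<union> {0}\<rbrakk> \<Longrightarrow> bracket (e r) (e s) = 0"
    and N_zero: "\<lbrakk>r \<in> \<Phi>; s \<in> \<Phi>; r + s \<notin> \<Phi> \<union> {0}\<rbrakk> \<Longrightarrow> N r s = 0"
    and N_uminus: "\<lbrakk>r \<in> \<Phi>; s \<in> \<Phi>; r + s \<in> \<Phi>\<rbrakk> \<Longrightarrow> N (- r) (- s) = - N r s"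

section \<open>The root system of type \<open>G\<^sub>2\<close>\<close>

definition \<a> :: "real ^ 3" where
  "\<a> = axis 1 1 - axis 2 1"

definition \<b> :: "real ^ 3" where
  "\<b> = - 2 *\<^sub>R axis 1 1 + axis 2 1 + axis 3 1"

definition G2_roots :: "(real ^ 3) set" where
  "G2_roots = (\<Union>r \<in> {\<a>, \<b>, \<a> + \<b>, 2 *\<^sub>R \<a> + \<b>, 3 *\<^sub>R \<a> + \<b>, 3 *\<^sub>R \<a> + 2 *\<^sub>R \<b>}. {r, - r})"

end

theory Submission
  imports Defs
begin

text \<open>
  The Jacobi identity on triples of root vectors gives three families of relations between the
  structure constants. A triple of roots with \<open>r + s + t = 0\<close> yields the proportions
  \<open>N r s / (t,t) = N s t / (r,r) = N t r / (s,s)\<close>, so together with \<open>N s r = - N r s\<close> and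
  \<open>N (-r) (-s) = - N r s\<close> one constant determines the twelve constants of \<open>\<plusminus>{r, s, t}\<close>.
  The \<open>60\<close> pairs of roots of \<open>G\<^sub>2\<close> whose sum is a root form five such classes, four of them
  represented by the extraspecial pairs. The triple \<open>a, b, 2a + b\<close> determines the fifth class, and
  the triples \<open>r, -r, s\<close> show that the signs square to \<open>1\<close>.
\<close>

section \<open>Relations between structure constants that follow from the Jacobi identity\<close>

context chevalley_basis
begin

lemma e_nonzero: "r \<in> \<Phi> \<Longrightarrow> e r \<noteq> 0"
  using independent_basis dependent_zero by (metis UnCI imageI)

lemma scale_e_eq_iff: "r \<in> \<Phi> \<Longrightarrow> scale c (e r) = scale d (e r) \<longleftrightarrow> c = d"
  by (simp add: e_nonzero)

lemma bracket_zero_left: "bracket 0 x = 0"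
  using bracket_add_left[of 0 0 x] by simp

lemma bracket_zero_right: "bracket x 0 = 0"
  using bracket_add_right[of x 0 0] by simp

lemma bracket_swap: "bracket y x = - bracket x y"
proof -
  have "bracket (x + y) (x + y) = bracket y x + bracket x y"
    by (simp add: bracket_add_left bracket_add_right bracket_self[of x] bracket_self[of y])
  then show ?thesis
    by (simp only: bracket_self eq_neg_iff_add_eq_0)
qed

lemma bracket_e_e':
  assumes "r \<in> \<Phi>" "s \<in> \<Phi>" "r + s \<noteq> 0"
  shows "bracket (e r) (e s) = scale (N r s) (e (r + s))"
  using assms bracket_e_e[of r s] bracket_e_e_zero[of r s] N_zero[of r s]
  by (cases "r + s \<in> \<Phi>") auto

lemma N_swap:
  assumes "r \<in> \<Phi>" "s \<in> \<Phi>" "r + s \<in> \<Phi>"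
  shows "N s r = - N r s"
proof -
  have "scale (N s r) (e (r + s)) = scale (- N r s) (e (r + s))"
    using bracket_swap[of "e s" "e r"] bracket_e_e[of r s] bracket_e_e[of s r] assms
    by (simp add: add.commute)
  then show ?thesis
    using assms by (simp only: scale_e_eq_iff)
qed

text \<open>If \<open>s + t\<close> is not a root, the inner bracket and \<open>N s t\<close> both
  vanish, so the formula needs no case distinction in later Jacobi computations.\<close>

lemma double_bracket_e:
  assumes "r \<in> \<Phi>" "s \<in> \<Phi>" "t \<in> \<Phi>" "s + t \<noteq> 0" "r + s + t \<noteq> 0"
  shows "bracket (e r) (bracket (e s) (e t)) = scale (N s t * N r (s + t)) (e (r + s + t))"
proof (cases "s + t \<in> \<Phi>")
  case True
  then show ?thesis
    using assms bracket_e_e'[of s t] bracket_e_e'[of r "s + t"]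
    by (simp add: bracket_scale_right add.assoc)
next
  case False
  then show ?thesis
    using assms by (simp add: bracket_e_e_zero N_zero bracket_zero_right)
qed

text \<open>The conditions on the sums keep all brackets inside root spaces, so the Jacobi identity
  for \<open>e r\<close>, \<open>e s\<close>, \<open>e t\<close> becomes the vanishing of a single
  coefficient, that of \<open>e (r + s + t)\<close>.\<close>

lemma N_jacobi:
  assumes "r \<in> \<Phi>" "s \<in> \<Phi>" "t \<in> \<Phi>" "r + s + t \<in> \<Phi>"
    and "r + s \<noteq> 0" "s + t \<noteq> 0" "t + r \<noteq> 0" "r + s + t \<noteq> 0"
  shows "N s t * N r (s + t) + N t r * N s (t + r) + N r s * N t (r + s) = 0"
proof -
  have eqs: "s + t + r = r + s + t" "t + r + s = r + s + t"
    by (simp_all add: algebra_simps)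
  have "scale (N s t * N r (s + t) + N t r * N s (t + r) + N r s * N t (r + s)) (e (r + s + t))
      = bracket (e r) (bracket (e s) (e t)) + bracket (e s) (bracket (e t) (e r))
        + bracket (e t) (bracket (e r) (e s))"
    using assms double_bracket_e[of r s t] double_bracket_e[of s t r] double_bracket_e[of t r s]
    by (simp add: eqs scale_left_distrib)
  also have "\<dots> = scale 0 (e (r + s + t))"
    by (simp add: jacobi)
  finally show ?thesis
    using assms(4) by (simp only: scale_e_eq_iff)
qed

text \<open>The Jacobi identity for \<open>e r\<close>, \<open>e (- r)\<close>, \<open>e s\<close>:
  the inner bracket \<open>h r\<close> contributes the Cartan integer. The relation links
  neighbouring steps of the \<open>r\<close>-string through \<open>s\<close>, and later fixes the
  squares of the signs.\<close>

lemma N_string: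
  assumes "r \<in> \<Phi>" "- r \<in> \<Phi>" "s \<in> \<Phi>" "s \<noteq> 0" "s \<noteq> r" "s \<noteq> - r"
  shows "N (- r) s * N r (s - r) - N r s * N (- r) (r + s) = of_real (2 * (r \<bullet> s) / (r \<bullet> r))"
proof -
  have nz: "r + s \<noteq> 0"
    using assms(6) by (metis add.commute eq_neg_iff_add_eq_0)
  have "bracket (e s) (bracket (e r) (e (- r)))
      = - scale (of_real (2 * (r \<bullet> s) / (r \<bullet> r))) (e s)"
    using bracket_swap[of "e s" "h r"] by (simp add: assms bracket_e_uminus bracket_h_e)
  moreover have "bracket (e r) (bracket (e (- r)) (e s))
      = scale (N (- r) s * N r (s - r)) (e s)"
    using double_bracket_e[of r "- r" s] assms by simp
  moreover have "bracket (e (- r)) (bracket (e s) (e r))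
      = - scale (N r s * N (- r) (r + s)) (e s)"
  proof -
    have "bracket (e (- r)) (bracket (e s) (e r)) = - bracket (e (- r)) (bracket (e r) (e s))"
      using bracket_swap[of "e r" "e s"] bracket_scale_right[of "e (- r)" "-1" "bracket (e r) (e s)"]
      by simp
    then show ?thesis
      using double_bracket_e[of "- r" r s] assms nz by simp
  qed
  ultimately have "scale (N (- r) s * N r (s - r) - N r s * N (- r) (r + s)) (e s)
      = scale (of_real (2 * (r \<bullet> s) / (r \<bullet> r))) (e s)"
    using jacobi[of "e r" "e (- r)" "e s"] by (simp add: scale_left_diff_distrib)
  then show ?thesis
    using assms(3) by (simp only: scale_e_eq_iff)
qed

lemma bracket_double_e_h:
  assumes "r \<in> \<Phi>" "s \<in> \<Phi>" "t \<in> \<Phi>" "- r \<in> \<Phi>" "r + s + t = 0"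
  shows "bracket (e r) (bracket (e s) (e t)) = scale (N s t) (h r)"
proof -
  have "s + t = - r"
    using assms(5) by (metis add.assoc add.commute eq_neg_iff_add_eq_0)
  then show ?thesis
    using assms bracket_e_e[of s t] by (simp add: bracket_scale_right bracket_e_uminus)
qed

text \<open>For roots with sum zero the Jacobi identity is a linear relation between
  \<open>h r\<close>, \<open>h s\<close> and \<open>h t\<close>. Bracketing it with
  \<open>e u\<close> makes it scalar, with no need to expand the coroot elements in the
  basis.\<close>

lemma N_cyclic_weights:
  assumes "r \<in> \<Phi>" "s \<in> \<Phi>" "t \<in> \<Phi>" "- r \<in> \<Phi>" "- s \<in> \<Phi>" "- t \<in> \<Phi>" "u \<in> \<Phi>"
    and sum0: "r + s + t = 0"
  shows "N s t * of_real (2 * (r \<bullet> u) / (r \<bullet> r)) + N t r * of_real (2 * (s \<bullet> u) / (s \<bullet> s))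
       + N r s * of_real (2 * (t \<bullet> u) / (t \<bullet> t)) = 0"
proof -
  have sums: "s + t + r = 0" "t + r + s = 0"
    using sum0 by (simp_all add: algebra_simps)
  have "scale (N s t) (h r) + scale (N t r) (h s) + scale (N r s) (h t) = 0"
    using jacobi[of "e r" "e s" "e t"] assms sums by (simp add: bracket_double_e_h)
  then have "bracket (scale (N s t) (h r) + scale (N t r) (h s) + scale (N r s) (h t)) (e u) = 0"
    by (simp add: bracket_zero_left)
  then have "scale (N s t * of_real (2 * (r \<bullet> u) / (r \<bullet> r))
      + N t r * of_real (2 * (s \<bullet> u) / (s \<bullet> s))
      + N r s * of_real (2 * (t \<bullet> u) / (t \<bullet> t))) (e u) = scale 0 (e u)"
    using assms
    by (simp only: bracket_add_left bracket_scale_left bracket_h_e scale_left_distrib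
        scale_scale scale_zero_left)
  then show ?thesis
    using assms(7) by (simp only: scale_e_eq_iff)
qed

text \<open>The condition \<open>indep\<close> excludes equality in Cauchy-Schwarz, so
  \<open>r\<close> and \<open>s\<close> are linearly independent. Testing the weight relation on
  \<open>u = r\<close> and \<open>u = s\<close> gives a homogeneous system with their Gram
  determinant.\<close>

lemma N_cyclic:
  assumes "r \<in> \<Phi>" "s \<in> \<Phi>" "t \<in> \<Phi>" "- r \<in> \<Phi>" "- s \<in> \<Phi>" "- t \<in> \<Phi>"
    and sum0: "r + s + t = 0"
    and indep: "(r \<bullet> r) * (s \<bullet> s) \<noteq> (r \<bullet> s)\<^sup>2"
  shows "N s t = of_real ((r \<bullet> r) / (t \<bullet> t)) * N r s"
    and "N t r = of_real ((s \<bullet> s) / (t \<bullet> t)) * N r s"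
proof -
  have t: "t = - (r + s)"
    using sum0 by (metis eq_neg_iff_add_eq_0 add.commute)
  have pos: "r \<bullet> r \<noteq> 0" "s \<bullet> s \<noteq> 0"
    using indep by auto
  have "t \<noteq> 0"
  proof
    assume "t = 0"
    then have "s = - r"
      using sum0 by (simp add: eq_neg_iff_add_eq_0 add.commute)
    then show False
      using indep by (simp add: power2_eq_square)
  qed
  \<comment> \<open>The factors \<open>2 / (r \<bullet> r)\<close> of the coroots are absorbed here,
    so the claim becomes \<open>x = y = z\<close>.\<close>
  define x y z where "x = N s t / of_real (r \<bullet> r)" and "y = N t r / of_real (s \<bullet> s)"
    and "z = N r s / of_real (t \<bullet> t)"
  define A B C :: complex where "A = of_real (r \<bullet> r)" and "B = of_real (r \<bullet> s)"
    and "C = of_real (s \<bullet> s)"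
  have weights: "x * of_real (r \<bullet> u) + y * of_real (s \<bullet> u) + z * of_real (t \<bullet> u) = 0"
    if "u \<in> \<Phi>" for u
  proof -
    have "N s t * of_real (2 * (r \<bullet> u) / (r \<bullet> r)) + N t r * of_real (2 * (s \<bullet> u) / (s \<bullet> s))
        + N r s * of_real (2 * (t \<bullet> u) / (t \<bullet> t))
        = 2 * (x * of_real (r \<bullet> u) + y * of_real (s \<bullet> u) + z * of_real (t \<bullet> u))"
      by (simp add: x_def y_def z_def field_simps)
    then show ?thesis
      using N_cyclic_weights[OF assms(1-6) that sum0] by (metis mult_eq_0_iff zero_neq_numeral)
  qed
  \<comment> \<open>Substituting \<open>t = - (r + s)\<close> leaves only the differences
    \<open>x - z\<close> and \<open>y - z\<close> as unknowns.\<close>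
  have 1: "(x - z) * A + (y - z) * B = 0"
    using weights[OF assms(1)]
    by (simp add: A_def B_def t inner_add_left algebra_simps inner_commute)
  have 2: "(x - z) * B + (y - z) * C = 0"
    using weights[OF assms(2)]
    by (simp add: B_def C_def t inner_add_left algebra_simps inner_commute)
  have "A * C - B\<^sup>2 = of_real ((r \<bullet> r) * (s \<bullet> s) - (r \<bullet> s)\<^sup>2)"
    by (simp add: A_def B_def C_def)
  then have det: "A * C - B\<^sup>2 \<noteq> 0"
    using indep by (simp del: of_real_diff of_real_mult of_real_power)
  have "(x - z) * (A * C - B\<^sup>2) = 0" "(y - z) * (A * C - B\<^sup>2) = 0"
    using 1 2 by algebra+
  with det have "x = z" "y = z" by auto
  then show "N s t = of_real ((r \<bullet> r) / (t \<bullet> t)) * N r s"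
    "N t r = of_real ((s \<bullet> s) / (t \<bullet> t)) * N r s"
    using pos \<open>t \<noteq> 0\<close> by (auto simp: x_def y_def z_def field_simps)
qed

text \<open>Collects the other eleven constants of a class. The separate value \<open>c\<close> lets
  the instances serve as rewrite rules to explicit values.\<close>

lemma N_triangle:
  assumes "r \<in> \<Phi>" "s \<in> \<Phi>" "t \<in> \<Phi>" "- r \<in> \<Phi>" "- s \<in> \<Phi>" "- t \<in> \<Phi>"
    and "r + s + t = 0" "(r \<bullet> r) * (s \<bullet> s) \<noteq> (r \<bullet> s)\<^sup>2" "N r s = c"
  shows "N s r = - c" "N (- r) (- s) = - c" "N (- s) (- r) = c"
    and "N s t = of_real ((r \<bullet> r) / (t \<bullet> t)) * c" "N t s = - of_real ((r \<bullet> r) / (t \<bullet> t)) * c"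
    and "N (- s) (- t) = - of_real ((r \<bullet> r) / (t \<bullet> t)) * c"
    and "N (- t) (- s) = of_real ((r \<bullet> r) / (t \<bullet> t)) * c"
    and "N t r = of_real ((s \<bullet> s) / (t \<bullet> t)) * c" "N r t = - of_real ((s \<bullet> s) / (t \<bullet> t)) * c"
    and "N (- t) (- r) = - of_real ((s \<bullet> s) / (t \<bullet> t)) * c"
    and "N (- r) (- t) = of_real ((s \<bullet> s) / (t \<bullet> t)) * c"
proof -
  \<comment> \<open>Each pairwise sum is the negative of the third root, hence a root, as
    \<open>N_swap\<close> and \<open>N_uminus\<close> require.\<close>
  have "r + s = - t" "s + t = - r" "t + r = - s"
    using assms(7) by (metis add.assoc add.commute eq_neg_iff_add_eq_0)+
  then have sums: "r + s \<in> \<Phi>" "s + t \<in> \<Phi>" "t + r \<in> \<Phi>" "s + r \<in> \<Phi>" "t + s \<in> \<Phi>" "r + t \<in> \<Phi>"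
    using assms by (simp_all add: add.commute)
  note cyc = N_cyclic[OF assms(1-8)]
  show "N s r = - c" "N (- r) (- s) = - c" "N (- s) (- r) = c"
    "N s t = of_real ((r \<bullet> r) / (t \<bullet> t)) * c" "N t s = - of_real ((r \<bullet> r) / (t \<bullet> t)) * c"
    "N (- s) (- t) = - of_real ((r \<bullet> r) / (t \<bullet> t)) * c"
    "N (- t) (- s) = of_real ((r \<bullet> r) / (t \<bullet> t)) * c"
    "N t r = of_real ((s \<bullet> s) / (t \<bullet> t)) * c" "N r t = - of_real ((s \<bullet> s) / (t \<bullet> t)) * c"
    "N (- t) (- r) = - of_real ((s \<bullet> s) / (t \<bullet> t)) * c"
    "N (- r) (- t) = of_real ((s \<bullet> s) / (t \<bullet> t)) * c"
    using assms sums cyc N_swap[of r s] N_swap[of s t] N_swap[of t r]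
    by (simp_all add: N_uminus)
qed

end

section \<open>Integer coordinates for the roots\<close>

definition ab :: "int \<Rightarrow> int \<Rightarrow> real ^ 3" where
  "ab i j = of_int i *\<^sub>R \<a> + of_int j *\<^sub>R \<b>"

lemma inner_ab: "ab i j \<bullet> ab k l = of_int (2 * i * k - 3 * i * l - 3 * j * k + 6 * j * l)"
proof -
  have "\<a> \<bullet> \<a> = 2" "\<a> \<bullet> \<b> = - 3" "\<b> \<bullet> \<a> = - 3" "\<b> \<bullet> \<b> = 6"
    by (simp_all add: \<a>_def \<b>_def inner_vec_def sum_3 axis_def)
  then show ?thesis
    by (simp add: ab_def inner_add_left inner_add_right algebra_simps)
qed

lemma ab_eq_iff [simp]: "ab i j = ab k l \<longleftrightarrow> i = k \<and> j = l"
proof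
  assume eq: "ab i j = ab k l"
  have comp: "ab i j $ 2 = of_int (j - i)" "ab i j $ 3 = of_int j" for i j
    by (simp_all add: ab_def \<a>_def \<b>_def axis_def)
  show "i = k \<and> j = l"
    using comp[of i j] comp[of k l] unfolding eq by simp
qed simp

lemma ab_eq_0_iff [simp]: "ab i j = 0 \<longleftrightarrow> i = 0 \<and> j = 0"
  using ab_eq_iff[of i j 0 0] by (simp add: ab_def)

text \<open>These rules bring every combination of roots into the form \<open>ab i j\<close>; with
  \<open>ab_eq_iff\<close>, equality and membership in the root set become integer arithmetic for
  the simplifier.\<close>

lemma ab_arith [simp]:
  "ab i j + ab k l = ab (i + k) (j + l)"
  "ab i j - ab k l = ab (i - k) (j - l)"
  "- ab i j = ab (- i) (- j)"
  "numeral n *\<^sub>R ab i j = ab (numeral n * i) (numeral n * j)"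
  "(- numeral n) *\<^sub>R ab i j = ab (- numeral n * i) (- numeral n * j)"
  by (simp_all add: ab_def algebra_simps)

lemma simple_roots_ab: "\<a> = ab 1 0" "\<b> = ab 0 1"
  by (simp_all add: ab_def)

lemma G2_roots_ab:
  "G2_roots = {ab (-3) (-2), ab (-3) (-1), ab (-2) (-1), ab (-1) (-1), ab 0 (-1), ab (-1) 0,
     ab 1 0, ab 0 1, ab 1 1, ab 2 1, ab 3 1, ab 3 2}"
  unfolding G2_roots_def simple_roots_ab by auto

text \<open>Unrolls a comprehension over an explicitly listed finite set, deciding \<open>P\<close>
  at one element at a time.\<close>

lemma graph_Collect_insert:
  "{(s, f s) | s. s \<in> insert x A \<and> P s}
     = (if P x then insert (x, f x) else id) {(s, f s) | s. s \<in> A \<and> P s}"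
  "{(s, f s) | s. s \<in> {} \<and> P s} = {}"
  by auto

section \<open>The five classes of structure constants and their signs\<close>

locale chevalley_basis_G2 = chevalley_basis scale bracket G2_roots "{\<a>, \<b>}" h e N
  for scale :: "complex \<Rightarrow> 'g::ab_group_add \<Rightarrow> 'g" and bracket
    and h e :: "real ^ 3 \<Rightarrow> 'g" and N +
  fixes \<epsilon>\<^sub>1 \<epsilon>\<^sub>2 \<epsilon>\<^sub>3 \<epsilon>\<^sub>4 \<epsilon>\<^sub>5 :: complex
  assumes \<epsilon>\<^sub>1: "N (ab 1 0) (ab 0 1) = \<epsilon>\<^sub>1"
    and \<epsilon>\<^sub>2: "N (ab 1 0) (ab 1 1) = 2 * \<epsilon>\<^sub>2"
    and \<epsilon>\<^sub>3: "N (ab 1 0) (ab 2 1) = 3 * \<epsilon>\<^sub>3"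
    and \<epsilon>\<^sub>4: "N (ab 0 1) (ab 3 1) = \<epsilon>\<^sub>4"
    and \<epsilon>\<^sub>5: "\<epsilon>\<^sub>5 = \<epsilon>\<^sub>1 * \<epsilon>\<^sub>3 / \<epsilon>\<^sub>4"
begin

text \<open>In this and the later classes the first simplification inserts the root list and the
  inner products, and the second discharges the side conditions and evaluates the length ratios. The
  remaining premise is the value of the representative.\<close>

lemmas N_class\<^sub>1 = N_triangle[of "ab 1 0" "ab 0 1" "ab (-1) (-1)" "\<epsilon>\<^sub>1",
    simplified G2_roots_ab inner_ab, simplified, OF \<epsilon>\<^sub>1]

lemmas N_class\<^sub>2 = N_triangle[of "ab 1 0" "ab 1 1" "ab (-2) (-1)" "2 * \<epsilon>\<^sub>2",
    simplified G2_roots_ab inner_ab, simplified, OF \<epsilon>\<^sub>2]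

lemmas N_class\<^sub>3 = N_triangle[of "ab 1 0" "ab 2 1" "ab (-3) (-1)" "3 * \<epsilon>\<^sub>3",
    simplified G2_roots_ab inner_ab, simplified, OF \<epsilon>\<^sub>3]

lemmas N_class\<^sub>4 = N_triangle[of "ab 0 1" "ab 3 1" "ab (-3) (-2)" "\<epsilon>\<^sub>4",
    simplified G2_roots_ab inner_ab, simplified, OF \<epsilon>\<^sub>4]

text \<open>The \<open>a\<close>-string \<open>b, a + b, 2a + b, 3a + b\<close> is climbed step by
  step, each square giving the next; \<open>\<epsilon>\<^sub>4\<close> comes from the
  \<open>b\<close>-string that starts at \<open>3a + b\<close>.\<close>

lemma \<epsilon>_square: "\<epsilon>\<^sub>1 * \<epsilon>\<^sub>1 = 1" "\<epsilon>\<^sub>2 * \<epsilon>\<^sub>2 = 1" "\<epsilon>\<^sub>3 * \<epsilon>\<^sub>3 = 1" "\<epsilon>\<^sub>4 * \<epsilon>\<^sub>4 = 1"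
proof -
  show 1: "\<epsilon>\<^sub>1 * \<epsilon>\<^sub>1 = 1"
    \<comment> \<open>The string starts at \<open>b\<close>, since \<open>b - a\<close> is not a
      root; what remains is \<open>3 * \<epsilon>\<^sub>1 * \<epsilon>\<^sub>1 = 3\<close>.\<close>
    using N_string[of "ab 1 0" "ab 0 1"] N_zero[of "ab (-1) 0" "ab 0 1"]
    by (simp add: G2_roots_ab inner_ab \<epsilon>\<^sub>1 \<epsilon>\<^sub>2 \<epsilon>\<^sub>3 \<epsilon>\<^sub>4 N_class\<^sub>1)
  show 2: "\<epsilon>\<^sub>2 * \<epsilon>\<^sub>2 = 1"
    \<comment> \<open>The relation reads \<open>3 * \<epsilon>\<^sub>1 * \<epsilon>\<^sub>1 - 4 *
      \<epsilon>\<^sub>2 * \<epsilon>\<^sub>2 = - 1\<close>.\<close>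
    using N_string[of "ab 1 0" "ab 1 1"] 1
    by (simp add: G2_roots_ab inner_ab \<epsilon>\<^sub>1 \<epsilon>\<^sub>2 \<epsilon>\<^sub>3 \<epsilon>\<^sub>4 N_class\<^sub>1 N_class\<^sub>2 mult.assoc)
  show "\<epsilon>\<^sub>3 * \<epsilon>\<^sub>3 = 1"
    \<comment> \<open>The relation reads \<open>4 * \<epsilon>\<^sub>2 * \<epsilon>\<^sub>2 - 3 *
      \<epsilon>\<^sub>3 * \<epsilon>\<^sub>3 = 1\<close>.\<close>
    using N_string[of "ab 1 0" "ab 2 1"] 2
    by (simp add: G2_roots_ab inner_ab \<epsilon>\<^sub>1 \<epsilon>\<^sub>2 \<epsilon>\<^sub>3 \<epsilon>\<^sub>4 N_class\<^sub>2 N_class\<^sub>3)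
  show "\<epsilon>\<^sub>4 * \<epsilon>\<^sub>4 = 1"
    using N_string[of "ab 0 1" "ab 3 1"] N_zero[of "ab 0 (-1)" "ab 3 1"]
    by (simp add: G2_roots_ab inner_ab \<epsilon>\<^sub>1 \<epsilon>\<^sub>2 \<epsilon>\<^sub>3 \<epsilon>\<^sub>4 N_class\<^sub>4)
qed

lemma \<epsilon>_nonzero [simp]: "\<epsilon>\<^sub>1 \<noteq> 0" "\<epsilon>\<^sub>2 \<noteq> 0" "\<epsilon>\<^sub>3 \<noteq> 0" "\<epsilon>\<^sub>4 \<noteq> 0" "\<epsilon>\<^sub>5 \<noteq> 0"
proof -
  show "\<epsilon>\<^sub>1 \<noteq> 0" "\<epsilon>\<^sub>2 \<noteq> 0" "\<epsilon>\<^sub>3 \<noteq> 0" "\<epsilon>\<^sub>4 \<noteq> 0"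
    using \<epsilon>_square by auto
  then show "\<epsilon>\<^sub>5 \<noteq> 0"
    by (simp add: \<epsilon>\<^sub>5)
qed

lemma N_2ab_ab: "N (ab 2 1) (ab 1 1) = 3 * \<epsilon>\<^sub>5"
proof -
  have "\<epsilon>\<^sub>1 * N (ab 2 1) (ab 1 1) = 3 * \<epsilon>\<^sub>3 * \<epsilon>\<^sub>4"
    \<comment> \<open>One of the three Jacobi terms drops out because \<open>2a + 2b\<close> is not
      a root.\<close>
    using N_jacobi[of "ab 1 0" "ab 0 1" "ab 2 1"] N_zero[of "ab 0 1" "ab 2 1"]
    by (simp add: G2_roots_ab \<epsilon>\<^sub>1 \<epsilon>\<^sub>2 \<epsilon>\<^sub>3 \<epsilon>\<^sub>4 N_class\<^sub>1 N_class\<^sub>3 N_class\<^sub>4)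
  moreover have "\<epsilon>\<^sub>5 * \<epsilon>\<^sub>4 = \<epsilon>\<^sub>1 * \<epsilon>\<^sub>3"
    by (simp add: \<epsilon>\<^sub>5)
  \<comment> \<open>As the signs square to 1, dividing by \<open>\<epsilon>\<^sub>1\<close> or
    \<open>\<epsilon>\<^sub>4\<close> is the same as multiplying by it.\<close>
  ultimately show ?thesis
    using \<epsilon>_square(1,4) by algebra
qed

lemmas N_class\<^sub>5 = N_triangle[of "ab 2 1" "ab 1 1" "ab (-3) (-2)" "3 * \<epsilon>\<^sub>5",
    simplified G2_roots_ab inner_ab, simplified, OF N_2ab_ab]

section \<open>The table of structure constants, row by row\<close>

lemma N_ab_zero:
  assumes "ab i j \<in> G2_roots" "ab k l \<in> G2_roots" "ab (i + k) (j + l) \<notin> G2_roots \<union> {0}"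
  shows "N (ab i j) (ab k l) = 0"
  using assms N_zero[of "ab i j" "ab k l"] by simp

lemmas N_values = \<epsilon>\<^sub>1 \<epsilon>\<^sub>2 \<epsilon>\<^sub>3 \<epsilon>\<^sub>4 N_2ab_ab N_class\<^sub>1 N_class\<^sub>2 N_class\<^sub>3 N_class\<^sub>4 N_class\<^sub>5

text \<open>A row is encoded as the graph of its nonzero part, so one set equation gives both the
  listed values and the vanishing of all others.\<close>

definition row :: "real ^ 3 \<Rightarrow> ((real ^ 3) \<times> complex) set" where
  "row r = {(s, N r s) | s. s \<in> G2_roots \<and> r + s \<noteq> 0 \<and> N r s \<noteq> 0}"

text \<open>Each of the twelve candidates \<open>s\<close> is settled by rewriting:
  \<open>s = - r\<close> is excluded, \<open>N_values\<close> and \<open>\<epsilon>_nonzero\<close>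
  keep the entries of the five classes, and \<open>N_ab_zero\<close> removes the rest.\<close>

lemma rows:
  "row (ab (-3) (-2)) =
     {(ab 0 1, \<epsilon>\<^sub>4), (ab 1 1, - \<epsilon>\<^sub>5), (ab 2 1, \<epsilon>\<^sub>5), (ab 3 1, - \<epsilon>\<^sub>4)}"
  "row (ab (-3) (-1)) =
     {(ab 0 (-1), \<epsilon>\<^sub>4), (ab 1 0, \<epsilon>\<^sub>3), (ab 2 1, - \<epsilon>\<^sub>3), (ab 3 2, - \<epsilon>\<^sub>4)}"
  "row (ab (-2) (-1)) =
     {(ab (-1) (-1), - 3 * \<epsilon>\<^sub>5), (ab (-1) 0, 3 * \<epsilon>\<^sub>3), (ab 1 0, 2 * \<epsilon>\<^sub>2),
      (ab 1 1, - 2 * \<epsilon>\<^sub>2), (ab 3 1, - \<epsilon>\<^sub>3), (ab 3 2, \<epsilon>\<^sub>5)}"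
  "row (ab (-1) (-1)) =
     {(ab (-2) (-1), 3 * \<epsilon>\<^sub>5), (ab (-1) 0, 2 * \<epsilon>\<^sub>2), (ab 1 0, 3 * \<epsilon>\<^sub>1),
      (ab 0 1, - \<epsilon>\<^sub>1), (ab 2 1, - 2 * \<epsilon>\<^sub>2), (ab 3 2, - \<epsilon>\<^sub>5)}"
  "row (ab 0 (-1)) =
     {(ab (-3) (-1), - \<epsilon>\<^sub>4), (ab (-1) 0, \<epsilon>\<^sub>1), (ab 1 1, - \<epsilon>\<^sub>1), (ab 3 2, \<epsilon>\<^sub>4)}"
  "row (ab (-1) 0) =
     {(ab (-2) (-1), - 3 * \<epsilon>\<^sub>3), (ab (-1) (-1), - 2 * \<epsilon>\<^sub>2), (ab 0 (-1), - \<epsilon>\<^sub>1),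
      (ab 1 1, 3 * \<epsilon>\<^sub>1), (ab 2 1, 2 * \<epsilon>\<^sub>2), (ab 3 1, \<epsilon>\<^sub>3)}"
  "row (ab 1 0) =
     {(ab (-3) (-1), - \<epsilon>\<^sub>3), (ab (-2) (-1), - 2 * \<epsilon>\<^sub>2), (ab (-1) (-1), - 3 * \<epsilon>\<^sub>1),
      (ab 0 1, \<epsilon>\<^sub>1), (ab 1 1, 2 * \<epsilon>\<^sub>2), (ab 2 1, 3 * \<epsilon>\<^sub>3)}"
  "row (ab 0 1) =
     {(ab (-3) (-2), - \<epsilon>\<^sub>4), (ab (-1) (-1), \<epsilon>\<^sub>1), (ab 1 0, - \<epsilon>\<^sub>1), (ab 3 1, \<epsilon>\<^sub>4)}"
  "row (ab 1 1) =
     {(ab (-3) (-2), \<epsilon>\<^sub>5), (ab (-2) (-1), 2 * \<epsilon>\<^sub>2), (ab (-1) 0, - 3 * \<epsilon>\<^sub>1),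
      (ab 0 (-1), \<epsilon>\<^sub>1), (ab 1 0, - 2 * \<epsilon>\<^sub>2), (ab 2 1, - 3 * \<epsilon>\<^sub>5)}"
  "row (ab 2 1) =
     {(ab (-3) (-2), - \<epsilon>\<^sub>5), (ab (-3) (-1), \<epsilon>\<^sub>3), (ab (-1) (-1), 2 * \<epsilon>\<^sub>2),
      (ab (-1) 0, - 2 * \<epsilon>\<^sub>2), (ab 1 0, - 3 * \<epsilon>\<^sub>3), (ab 1 1, 3 * \<epsilon>\<^sub>5)}"
  "row (ab 3 1) =
     {(ab (-3) (-2), \<epsilon>\<^sub>4), (ab (-2) (-1), \<epsilon>\<^sub>3), (ab (-1) 0, - \<epsilon>\<^sub>3), (ab 0 1, - \<epsilon>\<^sub>4)}"
  "row (ab 3 2) =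
     {(ab (-3) (-1), \<epsilon>\<^sub>4), (ab (-2) (-1), - \<epsilon>\<^sub>5), (ab (-1) (-1), \<epsilon>\<^sub>5), (ab 0 (-1), - \<epsilon>\<^sub>4)}"
  unfolding row_def G2_roots_ab graph_Collect_insert
  by (simp_all add: G2_roots_ab N_values N_ab_zero insert_commute)

lemma structure_constants_eq_Union_rows:
  "{(r, s, N r s) | r s. r \<in> G2_roots \<and> s \<in> G2_roots \<and> r + s \<noteq> 0 \<and> N r s \<noteq> 0}
     = (\<Union>r\<in>G2_roots. {r} \<times> row r)"
  unfolding row_def by auto

end

theorem theorem1:
  fixes scale :: "complex \<Rightarrow> 'g::ab_group_add \<Rightarrow> 'g"
    and bracket :: "'g \<Rightarrow> 'g \<Rightarrow> 'g"
    and h e :: "real ^ 3 \<Rightarrow> 'g"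
    and N :: "real ^ 3 \<Rightarrow> real ^ 3 \<Rightarrow> complex"
    and \<epsilon>\<^sub>1 \<epsilon>\<^sub>2 \<epsilon>\<^sub>3 \<epsilon>\<^sub>4 \<epsilon>\<^sub>5 :: complex
  assumes "simple_complex_lie_algebra scale bracket"
    and "chevalley_basis scale bracket G2_roots {\<a>, \<b>} h e N"
    and "N \<a> \<b> = \<epsilon>\<^sub>1"
    and "N \<a> (\<a> + \<b>) = 2 * \<epsilon>\<^sub>2"
    and "N \<a> (2 *\<^sub>R \<a> + \<b>) = 3 * \<epsilon>\<^sub>3"
    and "N \<b> (3 *\<^sub>R \<a> + \<b>) = \<epsilon>\<^sub>4"
    and "\<epsilon>\<^sub>5 = \<epsilon>\<^sub>1 * \<epsilon>\<^sub>3 / \<epsilon>\<^sub>4"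
  shows "{(r, s, N r s) | r s. r \<in> G2_roots \<and> s \<in> G2_roots \<and> r + s \<noteq> 0 \<and> N r s \<noteq> 0} =
        {- 3 *\<^sub>R \<a> - 2 *\<^sub>R \<b>} \<times> {(\<b>, \<epsilon>\<^sub>4), (\<a> + \<b>, - \<epsilon>\<^sub>5), (2 *\<^sub>R \<a> + \<b>, \<epsilon>\<^sub>5), (3 *\<^sub>R \<a> + \<b>, - \<epsilon>\<^sub>4)}
      \<union> {- 3 *\<^sub>R \<a> - \<b>} \<times> {(- \<b>, \<epsilon>\<^sub>4), (\<a>, \<epsilon>\<^sub>3), (2 *\<^sub>R \<a> + \<b>, - \<epsilon>\<^sub>3), (3 *\<^sub>R \<a> + 2 *\<^sub>R \<b>, - \<epsilon>\<^sub>4)}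
      \<union> {- 2 *\<^sub>R \<a> - \<b>} \<times> {(- \<a> - \<b>, - 3 * \<epsilon>\<^sub>5), (- \<a>, 3 * \<epsilon>\<^sub>3), (\<a>, 2 * \<epsilon>\<^sub>2), (\<a> + \<b>, - 2 * \<epsilon>\<^sub>2), (3 *\<^sub>R \<a> + \<b>, - \<epsilon>\<^sub>3), (3 *\<^sub>R \<a> + 2 *\<^sub>R \<b>, \<epsilon>\<^sub>5)}
      \<union> {- \<a> - \<b>} \<times> {(- 2 *\<^sub>R \<a> - \<b>, 3 * \<epsilon>\<^sub>5), (- \<a>, 2 * \<epsilon>\<^sub>2), (\<a>, 3 * \<epsilon>\<^sub>1), (\<b>, - \<epsilon>\<^sub>1), (2 *\<^sub>R \<a> + \<b>, - 2 * \<epsilon>\<^sub>2), (3 *\<^sub>R \<a> + 2 *\<^sub>R \<b>, - \<epsilon>\<^sub>5)}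
      \<union> {- \<b>} \<times> {(- 3 *\<^sub>R \<a> - \<b>, - \<epsilon>\<^sub>4), (- \<a>, \<epsilon>\<^sub>1), (\<a> + \<b>, - \<epsilon>\<^sub>1), (3 *\<^sub>R \<a> + 2 *\<^sub>R \<b>, \<epsilon>\<^sub>4)}
      \<union> {- \<a>} \<times> {(- 2 *\<^sub>R \<a> - \<b>, - 3 * \<epsilon>\<^sub>3), (- \<a> - \<b>, - 2 * \<epsilon>\<^sub>2), (- \<b>, - \<epsilon>\<^sub>1), (\<a> + \<b>, 3 * \<epsilon>\<^sub>1), (2 *\<^sub>R \<a> + \<b>, 2 * \<epsilon>\<^sub>2), (3 *\<^sub>R \<a> + \<b>, \<epsilon>\<^sub>3)}
      \<union> {\<a>} \<times> {(- 3 *\<^sub>R \<a> - \<b>, - \<epsilon>\<^sub>3), (- 2 *\<^sub>R \<a> - \<b>, - 2 * \<epsilon>\<^sub>2), (- \<a> - \<b>, - 3 * \<epsilon>\<^sub>1), (\<b>, \<epsilon>\<^sub>1), (\<a> + \<b>, 2 * \<epsilon>\<^sub>2), (2 *\<^sub>R \<a> + \<b>, 3 * \<epsilon>\<^sub>3)}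
      \<union> {\<b>} \<times> {(- 3 *\<^sub>R \<a> - 2 *\<^sub>R \<b>, - \<epsilon>\<^sub>4), (- \<a> - \<b>, \<epsilon>\<^sub>1), (\<a>, - \<epsilon>\<^sub>1), (3 *\<^sub>R \<a> + \<b>, \<epsilon>\<^sub>4)}
      \<union> {\<a> + \<b>} \<times> {(- 3 *\<^sub>R \<a> - 2 *\<^sub>R \<b>, \<epsilon>\<^sub>5), (- 2 *\<^sub>R \<a> - \<b>, 2 * \<epsilon>\<^sub>2), (- \<a>, - 3 * \<epsilon>\<^sub>1), (- \<b>, \<epsilon>\<^sub>1), (\<a>, - 2 * \<epsilon>\<^sub>2), (2 *\<^sub>R \<a> + \<b>, - 3 * \<epsilon>\<^sub>5)}
      \<union> {2 *\<^sub>R \<a> + \<b>} \<times> {(- 3 *\<^sub>R \<a> - 2 *\<^sub>R \<b>, - \<epsilon>\<^sub>5), (- 3 *\<^sub>R \<a> - \<b>, \<epsilon>\<^sub>3), (- \<a> - \<b>, 2 * \<epsilon>\<^sub>2), (- \<a>, - 2 * \<epsilon>\<^sub>2), (\<a>, - 3 * \<epsilon>\<^sub>3), (\<a> + \<b>, 3 * \<epsilon>\<^sub>5)}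
      \<union> {3 *\<^sub>R \<a> + \<b>} \<times> {(- 3 *\<^sub>R \<a> - 2 *\<^sub>R \<b>, \<epsilon>\<^sub>4), (- 2 *\<^sub>R \<a> - \<b>, \<epsilon>\<^sub>3), (- \<a>, - \<epsilon>\<^sub>3), (\<b>, - \<epsilon>\<^sub>4)}
      \<union> {3 *\<^sub>R \<a> + 2 *\<^sub>R \<b>} \<times> {(- 3 *\<^sub>R \<a> - \<b>, \<epsilon>\<^sub>4), (- 2 *\<^sub>R \<a> - \<b>, - \<epsilon>\<^sub>5), (- \<a> - \<b>, \<epsilon>\<^sub>5), (- \<b>, - \<epsilon>\<^sub>4)}"
proof -
  interpret chevalley_basis scale bracket G2_roots "{\<a>, \<b>}" h e N
    by (fact assms(2))
  interpret chevalley_basis_G2 scale bracket h e N \<epsilon>\<^sub>1 \<epsilon>\<^sub>2 \<epsilon>\<^sub>3 \<epsilon>\<^sub>4 \<epsilon>\<^sub>5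
    by unfold_locales (use assms(3-7) in \<open>simp_all add: simple_roots_ab\<close>)
  show ?thesis
    \<comment> \<open>The list in \<open>G2_roots_ab\<close> follows the order of the rows in the
      statement, so the expanded union agrees with it up to associativity.\<close>
    unfolding structure_constants_eq_Union_rows simple_roots_ab
    by (simp add: G2_roots_ab rows Un_assoc)
qed

end
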